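(* Let $d\ge 1$ and $B\ge 1$ be integers, let $\theta_0\in\mathbb{R}^d$, and let $\widehat{\theta}^{(1)},\ldots,\widehat{\theta}^{(B)}$ be independent and identically distributed random vectors in $\mathbb{R}^d$ such that $\widehat{\theta}^{(1)}-\theta_0\in\mathrm{MCH}$. Let $\delta := \mathrm{O\mbox{-}Med\mbox{-}bias}_P(\widehat{\theta}^{(1)};\theta_0)$. Then $$L(B,\delta;d)\ \le\ \mathbb{P}\left(\theta_0\notin \mathrm{Rect\mbox{-}Hull}_B\right)\ \le\ U(B,\delta;d),$$ where $$L(B,\delta;d):=\sum_{\substack{1\le j\le d\\ j\ \mathrm{odd}}}\binom{d}{j}2^j\left(\frac{1}{2^j}\right)^B-\sum_{\substack{1\le j\le d\\ j\ \mathrm{even}}}\binom{d}{j}\left((2^j-1)\left(\frac{1}{2^j}-\frac{\delta}{2^{j-1}}\right)^B+\left(\frac{1}{2^j}+(2^j-1)\frac{\delta}{2^{j-1}}\right)^B\right),$$ $$U(B,\delta;d):=\sum_{\substack{1\le j\le d\\ j\ \mathrm{odd}}}\binom{d}{j}\left((2^j-1)\left(\frac{1}{2^j}-\frac{\delta}{2^{j-1}}\right)^B+\left(\frac{1}{2^j}+(2^j-1)\frac{\delta}{2^{j-1}}\right)^B\right)-\sum_{\substack{1\le j\le d\\ j\ \mathrm{even}}}\binom{d}{j}2^j\left(\frac{1}{2^j}\right)^B.$$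
   Context: A random vector $W$ in $\mathbb{R}^d$ is said to be MCH (written $W\in\mathrm{MCH}$) if $\mathbb{P}(W_j=0\text{ for some }1\le j\le d)=0$. Let $\mathcal{O}^d$ be the collection of the $2^d$ closed orthants $\{x\in\mathbb{R}^d:\eta_jx_j\ge 0,\ 1\le j\le d\}$, $\eta\in\{-1,1\}^d$. For an estimator (random vector) $\widehat{\theta}$ with $\widehat{\theta}-\theta_0\in\mathrm{MCH}$, the orthant median bias about $\theta_0$ is $$\mathrm{O\mbox{-}Med\mbox{-}bias}_P(\widehat{\theta};\theta_0):=2^{d-1}\left(\frac{1}{2^d}-\min_{A\in\mathcal{O}^d}\mathbb{P}(\widehat{\theta}-\theta_0\in A)\right)_+,$$ where $(t)_+=\max\{t,0\}$ and $P$ denotes the underlying data distribution. The rectangular hull of $\widehat{\theta}^{(1)},\ldots,\widehat{\theta}^{(B)}$ is $$\mathrm{Rect\mbox{-}Hull}_B:=\prod_{j=1}^d\left[\min_{1\le k\le B}e_j^{\top}\widehat{\theta}^{(k)},\ \max_{1\le k\le B}e_j^{\top}\widehat{\theta}^{(k)}\right],$$ where $e_j$ is the $j$-th canonical basis vector of $\mathbb{R}^d$. *)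

theory Defs
  imports "HOL-Probability.Probability"
begin

text \<open>
  Measurability is part of the definition: without it the null-set condition would be met
  vacuously whenever the event fails to be measurable.
\<close>
definition MCH :: "'s measure \<Rightarrow> ('s \<Rightarrow> real ^ 'd) \<Rightarrow> bool" where
  "MCH M W \<longleftrightarrow> W \<in> borel_measurable M \<and> measure M {\<omega> \<in> space M. \<exists>j. W \<omega> $ j = 0} = 0"

definition orthants :: "(real ^ 'd) set set" where
  "orthants = {{x. \<forall>j. \<eta> $ j * x $ j \<ge> 0} | \<eta> :: real ^ 'd. \<forall>j. \<eta> $ j \<in> {-1, 1}}"

definition O_Med_bias :: "'s measure \<Rightarrow> ('s \<Rightarrow> real ^ 'd) \<Rightarrow> real ^ 'd \<Rightarrow> real" where
  "O_Med_bias M X \<theta>\<^sub>0 =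
     2 ^ (CARD('d) - 1) *
     max (1 / 2 ^ CARD('d) -
          Min ((\<lambda>A. measure M {\<omega> \<in> space M. X \<omega> - \<theta>\<^sub>0 \<in> A}) ` orthants)) 0"

definition Rect_Hull :: "nat \<Rightarrow> (nat \<Rightarrow> real ^ 'd) \<Rightarrow> (real ^ 'd) set" where
  "Rect_Hull B v =
     {x. \<forall>j. x $ j \<in> {Min ((\<lambda>k. v k $ j) ` {1..B}) .. Max ((\<lambda>k. v k $ j) ` {1..B})}}"

definition L_bound :: "nat \<Rightarrow> real \<Rightarrow> nat \<Rightarrow> real" where
  "L_bound B \<delta> d =
     (\<Sum>j | j \<in> {1..d} \<and> odd j. real (d choose j) * (2 ^ j * (1 / 2 ^ j) ^ B)) -
     (\<Sum>j | j \<in> {1..d} \<and> even j. real (d choose j) *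
        ((2 ^ j - 1) * (1 / 2 ^ j - \<delta> / 2 ^ (j - 1)) ^ B +
         (1 / 2 ^ j + (2 ^ j - 1) * (\<delta> / 2 ^ (j - 1))) ^ B))"

definition U_bound :: "nat \<Rightarrow> real \<Rightarrow> nat \<Rightarrow> real" where
  "U_bound B \<delta> d =
     (\<Sum>j | j \<in> {1..d} \<and> odd j. real (d choose j) *
        ((2 ^ j - 1) * (1 / 2 ^ j - \<delta> / 2 ^ (j - 1)) ^ B +
         (1 / 2 ^ j + (2 ^ j - 1) * (\<delta> / 2 ^ (j - 1))) ^ B)) -
     (\<Sum>j | j \<in> {1..d} \<and> even j. real (d choose j) * (2 ^ j * (1 / 2 ^ j) ^ B))"

end

theory Submission imports Defs
begin

text \<open>
  Up to null events, \<open>\<theta>\<^sub>0\<close> lies outside the hull iff some coordinate of the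
  errors \<open>X k - \<theta>\<^sub>0\<close> has the same sign for all \<open>k\<close>. By inclusion-exclusion over
  the set \<open>J\<close> of such coordinates, the probability is an alternating sum of terms
  \<open>\<Sum>\<^sub>T p(J,T)^B\<close>, where \<open>p(J,T)\<close> is the probability that \<open>T\<close> is the set of positive coordinates
  within \<open>J\<close>. For fixed \<open>J\<close> the \<open>2^|J|\<close> numbers \<open>p(J,T)\<close> sum to 1, and each is at least
  \<open>1/2^|J| - \<delta>/2^(|J|-1)\<close>, being a sum of \<open>2^(d-|J|)\<close> orthant probabilities. Convexity of
  \<open>x^B\<close> then bounds the power sum from below by its value at the uniform vector and from above by
  its value at an extreme point of this simplex.
\<close>

section \<open>Power sums over a truncated simplex\<close>

text \<open>Jensen's inequality for the \<open>n\<close>-th power on the nonnegative reals, with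
  equal weights.\<close>

lemma sum_power_ge_uniform:
  fixes p :: "'a \<Rightarrow> real"
  assumes "finite S" "S \<noteq> {}" and p: "\<And>i. i \<in> S \<Longrightarrow> 0 \<le> p i"
  shows "real (card S) * (sum p S / real (card S)) ^ n \<le> (\<Sum>i\<in>S. p i ^ n)"
proof -
  let ?c = "real (card S)"
  have c: "?c > 0"
    using assms by (simp add: card_gt_0_iff)
  have conv: "convex_on {0::real..} (\<lambda>x. x ^ n)"
    by (cases "even n") (auto intro: convex_power_odd convex_on_subset[OF convex_power_even])
  have "(\<Sum>i\<in>S. (1 / ?c) *\<^sub>R p i) ^ n \<le> (\<Sum>i\<in>S. (1 / ?c) * p i ^ n)"
    using assms c by (intro convex_on_sum[OF _ _ conv]) auto
  then show ?thesis
    using c by (simp add: field_simps flip: sum_divide_distrib)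
qed

text \<open>Lowering \<open>y\<close> to \<open>a\<close> and raising \<open>x\<close> by the same
  amount keeps the sum. Both resulting differences of powers contain the factor
  \<open>y - a\<close>, and the cofactors compare termwise because \<open>a \<le> x\<close> and
  \<open>y \<le> x + y - a\<close>.\<close>

lemma power_add_le_spread:
  fixes a x y :: real
  assumes "0 \<le> a" "a \<le> x" "a \<le> y"
  shows "x ^ n + y ^ n \<le> a ^ n + (x + y - a) ^ n"
proof -
  have "y ^ n - a ^ n = (y - a) * (\<Sum>i<n. a ^ (n - Suc i) * y ^ i)"
    by (rule power_diff_sumr2)
  also have "\<dots> \<le> (y - a) * (\<Sum>i<n. x ^ (n - Suc i) * (x + y - a) ^ i)"
    using assms by (intro mult_left_mono sum_mono mult_mono power_mono) auto
  also have "\<dots> = (x + y - a) ^ n - x ^ n"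
    by (simp add: power_diff_sumr2[of "x + y - a" n x])
  finally show ?thesis
    by simp
qed

text \<open>By induction all mass above the floor \<open>a\<close> is moved into a single entry:
  each new entry is spread against the exceptional entry of the vector built so far.\<close>

lemma sum_power_le_extreme:
  fixes p :: "'a \<Rightarrow> real"
  assumes "finite S" "S \<noteq> {}" "0 \<le> a" "\<And>i. i \<in> S \<Longrightarrow> a \<le> p i"
  shows "(\<Sum>i\<in>S. p i ^ n) \<le> (real (card S) - 1) * a ^ n + (sum p S - (real (card S) - 1) * a) ^ n"
  using assms
proof (induction S rule: finite_ne_induct)
  case (singleton x)
  then show ?case by simp
next
  case (insert x F)
  \<comment> \<open>The exceptional entry for \<open>F\<close>, when all its other entries equal
    \<open>a\<close>.\<close>
  let ?y = "sum p F - (real (card F) - 1) * a"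
  have "a \<le> ?y"
    using sum_mono[of F "\<lambda>_. a" p] insert.prems by (simp add: algebra_simps)
  then have "p x ^ n + ?y ^ n \<le> a ^ n + (p x + ?y - a) ^ n"
    using insert.prems by (intro power_add_le_spread) auto
  moreover have "(\<Sum>i\<in>F. p i ^ n) \<le> (real (card F) - 1) * a ^ n + ?y ^ n"
    using insert by auto
  moreover have "p x + ?y - a = sum p (insert x F) - (real (card (insert x F)) - 1) * a"
    using insert.hyps by (simp add: algebra_simps)
  ultimately show ?case
    using insert.hyps by (simp add: algebra_simps)
qed

section \<open>Sums over nonempty subsets\<close>

lemma sum_nonempty_subsets_card:
  fixes h :: "nat \<Rightarrow> real"
  shows "(\<Sum>J | J \<noteq> ({} :: 'd::finite set). h (card J))
       = (\<Sum>j\<in>{1..CARD('d)}. real (CARD('d) choose j) * h j)"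
proof -
  have "(\<Sum>J | J \<noteq> ({} :: 'd set). h (card J))
      = (\<Sum>j\<in>{1..CARD('d)}. \<Sum>J | J \<in> {J :: 'd set. J \<noteq> {}} \<and> card J = j. h (card J))"
    by (rule sum.group[symmetric])
       (auto simp: Suc_le_eq card_gt_0_iff card_mono)
  also have "\<dots> = (\<Sum>j\<in>{1..CARD('d)}. real (CARD('d) choose j) * h j)"
  proof (rule sum.cong[OF refl])
    fix j assume "j \<in> {1..CARD('d)}"
    then have "{J \<in> {J :: 'd set. J \<noteq> {}}. card J = j} = {J. J \<subseteq> UNIV \<and> card J = j}"
      by auto
    then show "(\<Sum>J | J \<in> {J :: 'd set. J \<noteq> {}} \<and> card J = j. h (card J))
             = real (CARD('d) choose j) * h j"
      using n_subsets[of "UNIV :: 'd set" j] by simp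
  qed
  finally show ?thesis .
qed

lemma sum_nonempty_subsets_parity:
  fixes f g :: "nat \<Rightarrow> real"
  shows "(\<Sum>J | J \<noteq> ({} :: 'd::finite set). if odd (card J) then f (card J) else - g (card J))
       = (\<Sum>j | j \<in> {1..CARD('d)} \<and> odd j. real (CARD('d) choose j) * f j)
       - (\<Sum>j | j \<in> {1..CARD('d)} \<and> even j. real (CARD('d) choose j) * g j)"
proof -
  have "(\<Sum>J | J \<noteq> ({} :: 'd set). if odd (card J) then f (card J) else - g (card J))
      = (\<Sum>j\<in>{1..CARD('d)}. real (CARD('d) choose j) * (if odd j then f j else - g j))"
    by (rule sum_nonempty_subsets_card)
  also have "\<dots> = (\<Sum>j\<in>{1..CARD('d)}. if odd j then real (CARD('d) choose j) * f j
                                       else - (real (CARD('d) choose j) * g j))"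
    by (intro sum.cong) auto
  also have "\<dots> = (\<Sum>j\<in>{1..CARD('d)} \<inter> {j. odd j}. real (CARD('d) choose j) * f j)
                + (\<Sum>j\<in>{1..CARD('d)} \<inter> - {j. odd j}. - (real (CARD('d) choose j) * g j))"
    by (rule sum.If_cases) simp
  finally show ?thesis
    by (simp add: sum_negf Int_def)
qed

text \<open>Odd sets enter with a plus sign and even sets with a minus sign, so each one-sided bound
  mixes \<open>lo\<close> and \<open>hi\<close>. Grouping by cardinality produces the binomial
  coefficients.\<close>

lemma alternating_sum_nonempty_subsets_bounds:
  fixes F :: "'d::finite set \<Rightarrow> real" and lo hi :: "nat \<Rightarrow> real"
  assumes lo: "\<And>J. J \<noteq> {} \<Longrightarrow> lo (card J) \<le> F J"
    and hi: "\<And>J. J \<noteq> {} \<Longrightarrow> F J \<le> hi (card J)"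
  shows "(\<Sum>j | j \<in> {1..CARD('d)} \<and> odd j. real (CARD('d) choose j) * lo j)
       - (\<Sum>j | j \<in> {1..CARD('d)} \<and> even j. real (CARD('d) choose j) * hi j)
       \<le> (\<Sum>J | J \<noteq> {}. (- 1) ^ (card J + 1) * F J)" (is ?lower)
    and "(\<Sum>J | J \<noteq> {}. (- 1) ^ (card J + 1) * F J)
       \<le> (\<Sum>j | j \<in> {1..CARD('d)} \<and> odd j. real (CARD('d) choose j) * hi j)
       - (\<Sum>j | j \<in> {1..CARD('d)} \<and> even j. real (CARD('d) choose j) * lo j)" (is ?upper)
proof -
  show ?lower
    unfolding sum_nonempty_subsets_parity[symmetric]
    using lo hi by (intro sum_mono) auto
  show ?upper
    unfolding sum_nonempty_subsets_parity[symmetric]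
    using lo hi by (intro sum_mono) auto
qed

text \<open>Such a set is \<open>T\<close> together with an arbitrary subset of the complement of
  \<open>J\<close>.\<close>

lemma card_subsets_with_trace:
  fixes J T :: "'d::finite set"
  assumes "T \<subseteq> J"
  shows "card {S. S \<inter> J = T} = 2 ^ (CARD('d) - card J)"
proof -
  have "bij_betw (\<lambda>S. T \<union> S) (Pow (- J)) {S. S \<inter> J = T}"
    using assms by (intro bij_betw_byWitness[where f' = "\<lambda>S. S - J"]) auto
  then have "card {S. S \<inter> J = T} = card (Pow (- J))"
    by (simp add: bij_betw_same_card)
  then show ?thesis
    by (simp add: card_Pow Compl_eq_Diff_UNIV card_Diff_subset)
qed

section \<open>Random sign patterns\<close>

text \<open>
  A sign pattern is encoded by the set of its positive coordinates, so it takes values in the finite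
  type \<^typ>\<open>'d set\<close>.
\<close>

context prob_space
begin

lemma sum_prob_finite_partition:
  fixes f :: "'a \<Rightarrow> 'b"
  assumes f: "random_variable (count_space UNIV) f" and "finite S"
  shows "(\<Sum>s\<in>S. \<P>(\<omega> in M. f \<omega> = s)) = \<P>(\<omega> in M. f \<omega> \<in> S)"
proof -
  have "prob (\<Union>s\<in>S. {\<omega> \<in> space M. f \<omega> = s}) = (\<Sum>s\<in>S. \<P>(\<omega> in M. f \<omega> = s))"
    using assms by (intro finite_measure_finite_Union) (auto simp: disjoint_family_on_def)
  moreover have "(\<Union>s\<in>S. {\<omega> \<in> space M. f \<omega> = s}) = {\<omega> \<in> space M. f \<omega> \<in> S}"
    by auto
  ultimately show ?thesis by simp
qed

text \<open>The trace event is the disjoint union of the events for the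
  \<open>2 ^ (CARD('d) - card J)\<close> full patterns that extend \<open>T\<close>.\<close>

lemma prob_trace_ge:
  fixes \<sigma> :: "'a \<Rightarrow> 'd::finite set"
  assumes \<sigma>: "random_variable (count_space UNIV) \<sigma>"
    and m: "\<And>S. m \<le> \<P>(\<omega> in M. \<sigma> \<omega> = S)" and "T \<subseteq> J"
  shows "2 ^ (CARD('d) - card J) * m \<le> \<P>(\<omega> in M. \<sigma> \<omega> \<inter> J = T)"
proof -
  have "2 ^ (CARD('d) - card J) * m = (\<Sum>S | S \<inter> J = T. m)"
    by (simp add: card_subsets_with_trace[OF \<open>T \<subseteq> J\<close>])
  also have "\<dots> \<le> (\<Sum>S | S \<inter> J = T. \<P>(\<omega> in M. \<sigma> \<omega> = S))"
    by (intro sum_mono m)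
  also have "\<dots> = \<P>(\<omega> in M. \<sigma> \<omega> \<in> {S. S \<inter> J = T})"
    by (rule sum_prob_finite_partition[OF \<sigma>]) simp
  finally show ?thesis by simp
qed

text \<open>All coordinates in \<open>J\<close> keep their sign iff the patterns share a common
  trace \<open>T\<close> on \<open>J\<close>. These events are disjoint over \<open>T\<close>, and
  independence makes each one a product of \<open>B\<close> equal factors.\<close>

lemma prob_constant_trace:
  fixes \<sigma> :: "nat \<Rightarrow> 'a \<Rightarrow> 'd::finite set"
  assumes ind: "indep_vars (\<lambda>_. count_space UNIV) \<sigma> {1..B}" and "B \<ge> 1"
    and ident: "\<And>k S. k \<in> {1..B} \<Longrightarrow> \<P>(\<omega> in M. \<sigma> k \<omega> \<in> S) = \<P>(\<omega> in M. \<sigma> 1 \<omega> \<in> S)"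
  shows "\<P>(\<omega> in M. \<forall>j\<in>J. (\<forall>k\<in>{1..B}. j \<in> \<sigma> k \<omega>) \<or> (\<forall>k\<in>{1..B}. j \<notin> \<sigma> k \<omega>))
       = (\<Sum>T\<in>Pow J. \<P>(\<omega> in M. \<sigma> 1 \<omega> \<inter> J = T) ^ B)"
proof -
  have rv: "random_variable (count_space UNIV) (\<sigma> k)" if "k \<in> {1..B}" for k
    using ind that unfolding indep_vars_def by blast
  let ?E = "\<lambda>T. {\<omega> \<in> space M. \<forall>k\<in>{1..B}. \<sigma> k \<omega> \<inter> J = T}"
  have E: "?E T = (\<Inter>k\<in>{1..B}. \<sigma> k -` {S. S \<inter> J = T} \<inter> space M)" for T
    using \<open>B \<ge> 1\<close> by (auto simp: Bex_def)
  have "?E T \<in> events" for T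
    unfolding E using rv \<open>B \<ge> 1\<close> by (intro sets.finite_INT measurable_sets) auto
  \<comment> \<open>Disjointness uses \<open>B \<ge> 1\<close>: the first pattern determines
    \<open>T\<close>.\<close>
  then have "prob (\<Union>T\<in>Pow J. ?E T) = (\<Sum>T\<in>Pow J. prob (?E T))"
    using \<open>B \<ge> 1\<close>
    by (intro finite_measure_finite_Union) (auto simp: disjoint_family_on_def)
  moreover have "(\<Union>T\<in>Pow J. ?E T)
      = {\<omega> \<in> space M. \<forall>j\<in>J. (\<forall>k\<in>{1..B}. j \<in> \<sigma> k \<omega>) \<or> (\<forall>k\<in>{1..B}. j \<notin> \<sigma> k \<omega>)}"
    (is "?L = ?R")
  proof (intro equalityI subsetI)
    fix \<omega> assume "\<omega> \<in> ?L"
    then obtain T where "\<omega> \<in> space M" "T \<subseteq> J" and T: "\<And>k. k \<in> {1..B} \<Longrightarrow> \<sigma> k \<omega> \<inter> J = T"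
      by auto
    have "j \<in> \<sigma> k \<omega> \<longleftrightarrow> j \<in> T" if "j \<in> J" "k \<in> {1..B}" for j k
      using T[OF that(2)] that(1) by blast
    then show "\<omega> \<in> ?R"
      using \<open>\<omega> \<in> space M\<close> by (simp del: atLeastAtMost_iff)
  next
    fix \<omega> assume "\<omega> \<in> ?R"
    then have "\<omega> \<in> ?E (\<sigma> 1 \<omega> \<inter> J)"
      using \<open>B \<ge> 1\<close> by fastforce
    then show "\<omega> \<in> ?L"
      by (rule UN_I[rotated]) simp
  qed
  moreover have "prob (?E T) = \<P>(\<omega> in M. \<sigma> 1 \<omega> \<inter> J = T) ^ B" for T
  proof -
    have "prob (?E T) = (\<Prod>k\<in>{1..B}. prob (\<sigma> k -` {S. S \<inter> J = T} \<inter> space M))"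
      unfolding E using \<open>B \<ge> 1\<close>
      by (intro indep_varsD_finite[OF ind, where A = "\<lambda>_. {S. S \<inter> J = T}"]) auto
    also have "\<dots> = (\<Prod>k\<in>{1..B}. \<P>(\<omega> in M. \<sigma> 1 \<omega> \<inter> J = T))"
    proof (rule prod.cong[OF refl])
      fix k assume k: "k \<in> {1..B}"
      have "\<sigma> k -` {S. S \<inter> J = T} \<inter> space M = {\<omega> \<in> space M. \<sigma> k \<omega> \<in> {S. S \<inter> J = T}}"
        by blast
      then show "prob (\<sigma> k -` {S. S \<inter> J = T} \<inter> space M) = \<P>(\<omega> in M. \<sigma> 1 \<omega> \<inter> J = T)"
        using ident[OF k, of "{S. S \<inter> J = T}"] by simp
    qed
    finally show ?thesis by simp
  qed
  ultimately show ?thesis by simp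
qed

lemma prob_Ex_inclusion_exclusion:
  fixes Q :: "'d::finite \<Rightarrow> 'a \<Rightarrow> bool"
  assumes Q: "\<And>j. {\<omega> \<in> space M. Q j \<omega>} \<in> events"
  shows "\<P>(\<omega> in M. \<exists>j. Q j \<omega>)
       = (\<Sum>J | J \<noteq> {}. (- 1) ^ (card J + 1) * \<P>(\<omega> in M. \<forall>j\<in>J. Q j \<omega>))"
proof -
  interpret IE: Incl_Excl "\<lambda>A. A \<in> events" prob
    by unfold_locales (auto simp: disjnt_def finite_measure_Union)
  have "prob (\<Union>j\<in>UNIV. {\<omega> \<in> space M. Q j \<omega>})
      = (\<Sum>J | J \<subseteq> UNIV \<and> J \<noteq> {}. (- 1) ^ (card J + 1) * prob (\<Inter>j\<in>J. {\<omega> \<in> space M. Q j \<omega>}))"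
    by (rule IE.restricted_indexed) (use Q in auto)
  moreover have "(\<Union>j\<in>UNIV. {\<omega> \<in> space M. Q j \<omega>}) = {\<omega> \<in> space M. \<exists>j. Q j \<omega>}"
    by auto
  \<comment> \<open>For empty \<open>J\<close> the intersection would be \<open>UNIV\<close> instead
    of \<open>space M\<close>.\<close>
  moreover have "(\<Inter>j\<in>J. {\<omega> \<in> space M. Q j \<omega>}) = {\<omega> \<in> space M. \<forall>j\<in>J. Q j \<omega>}" if "J \<noteq> {}" for J
    using that by auto
  ultimately show ?thesis by simp
qed

text \<open>
  Here \<open>m\<close> is a lower bound for all pattern probabilities, and \<open>\<delta>\<close> is its deficit from the uniform
  value \<open>1/2^d\<close>, in the normalisation of \<^const>\<open>O_Med_bias\<close>.
\<close>

lemma prob_constant_coordinate_bounds: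
  fixes \<sigma> :: "nat \<Rightarrow> 'a \<Rightarrow> 'd::finite set"
  assumes ind: "indep_vars (\<lambda>_. count_space UNIV) \<sigma> {1..B}" and "B \<ge> 1"
    and ident: "\<And>k S. k \<in> {1..B} \<Longrightarrow> \<P>(\<omega> in M. \<sigma> k \<omega> \<in> S) = \<P>(\<omega> in M. \<sigma> 1 \<omega> \<in> S)"
    and m: "0 \<le> m" "\<And>S. m \<le> \<P>(\<omega> in M. \<sigma> 1 \<omega> = S)"
    and \<delta>: "m = 1 / 2 ^ CARD('d) - \<delta> / 2 ^ (CARD('d) - 1)"
  defines "p \<equiv> \<P>(\<omega> in M. \<exists>j. (\<forall>k\<in>{1..B}. j \<in> \<sigma> k \<omega>) \<or> (\<forall>k\<in>{1..B}. j \<notin> \<sigma> k \<omega>))"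
  shows "L_bound B \<delta> CARD('d) \<le> p" "p \<le> U_bound B \<delta> CARD('d)"
proof -
  have rv: "random_variable (count_space UNIV) (\<sigma> k)" if "k \<in> {1..B}" for k
    using ind that unfolding indep_vars_def by blast
  have rv1: "random_variable (count_space UNIV) (\<sigma> 1)"
    using rv \<open>B \<ge> 1\<close> by simp
  define F where "F J = (\<Sum>T\<in>Pow J. \<P>(\<omega> in M. \<sigma> 1 \<omega> \<inter> J = T) ^ B)" for J
  have F_eq: "F J = \<P>(\<omega> in M. \<forall>j\<in>J. (\<forall>k\<in>{1..B}. j \<in> \<sigma> k \<omega>) \<or> (\<forall>k\<in>{1..B}. j \<notin> \<sigma> k \<omega>))" for J
    unfolding F_def
    by (rule prob_constant_trace[OF ind \<open>B \<ge> 1\<close>, symmetric]) (rule ident)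
  have "{\<omega> \<in> space M. (\<forall>k\<in>{1..B}. j \<in> \<sigma> k \<omega>) \<or> (\<forall>k\<in>{1..B}. j \<notin> \<sigma> k \<omega>)} \<in> events" for j
  proof -
    have *: "{\<omega> \<in> space M. P (\<sigma> k \<omega>)} \<in> events" if "k \<in> {1..B}" for P k
      using measurable_sets[OF rv[OF that], of "{S. P S}"]
      by (simp add: vimage_def Int_def conj_commute)
    show ?thesis
      by (intro sets.sets_Collect_disj sets.sets_Collect_finite_All' *) (use \<open>B \<ge> 1\<close> in auto)
  qed
  then have p: "p = (\<Sum>J | J \<noteq> {}. (- 1) ^ (card J + 1) * F J)"
    unfolding p_def F_eq by (rule prob_Ex_inclusion_exclusion)
  \<comment> \<open>Values of the power sum at the uniform vector (\<open>lo\<close>) and at an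
    extreme point of the truncated simplex (\<open>hi\<close>).\<close>
  define lo where "lo j = 2 ^ j * (1 / 2 ^ j :: real) ^ B" for j :: nat
  define hi where "hi j = (2 ^ j - 1) * (1 / 2 ^ j - \<delta> / 2 ^ (j - 1)) ^ B
      + (1 / 2 ^ j + (2 ^ j - 1) * (\<delta> / 2 ^ (j - 1))) ^ B" for j :: nat
  have F: "lo (card J) \<le> F J" "F J \<le> hi (card J)" if "J \<noteq> {}" for J
  proof -
    let ?p = "\<lambda>T. \<P>(\<omega> in M. \<sigma> 1 \<omega> \<inter> J = T)"
    have card: "real (card (Pow J)) = 2 ^ card J"
      by (simp add: card_Pow)
    have "random_variable (count_space UNIV) (\<lambda>\<omega>. \<sigma> 1 \<omega> \<inter> J)"
      using measurable_compose[OF rv1, of "\<lambda>S. S \<inter> J" "count_space UNIV"] by simp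
    then have sum1: "(\<Sum>T\<in>Pow J. ?p T) = 1"
      using sum_prob_finite_partition[of "\<lambda>\<omega>. \<sigma> 1 \<omega> \<inter> J" "Pow J"] by (simp add: prob_space)
    define a where "a = 1 / 2 ^ card J - \<delta> / 2 ^ (card J - 1)"
    \<comment> \<open>These keep the natural subtractions in the exponents from truncating, so that
      summing \<open>2 ^ (CARD('d) - card J)\<close> copies of \<open>m\<close> gives exactly the
      floor \<open>a\<close>.\<close>
    have "card J \<ge> 1" "card J \<le> CARD('d)"
      using that by (simp_all add: Suc_le_eq card_gt_0_iff card_mono)
    then have a: "a = 2 ^ (CARD('d) - card J) * m"
      by (simp add: a_def \<delta> power_diff field_simps)
    have "(\<Sum>T\<in>Pow J. ?p T ^ B)
        \<le> (real (card (Pow J)) - 1) * a ^ B + (sum ?p (Pow J) - (real (card (Pow J)) - 1) * a) ^ B"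
      using m(1) prob_trace_ge[OF rv1 m(2)]
      by (intro sum_power_le_extreme) (auto simp: a)
    then have "F J \<le> (2 ^ card J - 1) * a ^ B + (1 - (2 ^ card J - 1) * a) ^ B"
      unfolding F_def card sum1 .
    \<comment> \<open>The mass left for the exceptional entry.\<close>
    moreover have "1 - (2 ^ card J - 1) * a
        = 1 / 2 ^ card J + (2 ^ card J - 1) * (\<delta> / 2 ^ (card J - 1))"
      by (simp add: a_def diff_divide_distrib algebra_simps)
    ultimately show "F J \<le> hi (card J)"
      by (simp add: hi_def a_def)
    show "lo (card J) \<le> F J"
      using sum_power_ge_uniform[of "Pow J" ?p B] unfolding card sum1 F_def lo_def by auto
  qed
  show "L_bound B \<delta> CARD('d) \<le> p"
    using alternating_sum_nonempty_subsets_bounds(1)[of lo F hi] F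
    by (simp add: p L_bound_def lo_def hi_def)
  show "p \<le> U_bound B \<delta> CARD('d)"
    using alternating_sum_nonempty_subsets_bounds(2)[of lo F hi] F
    by (simp add: p U_bound_def lo_def hi_def)
qed

end

section \<open>The orthant median bias in terms of sign patterns\<close>

text \<open>Zero coordinates are grouped with the negative ones; under \<open>MCH\<close> this
  affects only a null event.\<close>

definition pos_coords :: "real ^ 'd \<Rightarrow> 'd set" where
  "pos_coords x = {j. x $ j > 0}"

lemma measurable_pos_coords [measurable]: "pos_coords \<in> borel \<rightarrow>\<^sub>M count_space UNIV"
proof (rule measurable_count_space_eq2[THEN iffD2])
  show "finite (UNIV :: 'a set set)" by simp
  have "pos_coords -` {S} \<inter> space borel = {x :: real ^ 'a. \<forall>j. j \<in> S \<longleftrightarrow> x $ j > 0}" for S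
    by (auto simp: pos_coords_def)
  also have "\<dots> S = {x \<in> space borel. \<forall>j. j \<in> S \<longleftrightarrow> x $ j > 0}" for S by simp
  also have "\<dots> S \<in> sets borel" for S by measurable
  finally show "pos_coords \<in> space borel \<rightarrow> UNIV \<and>
      (\<forall>S\<in>UNIV. pos_coords -` {S} \<inter> space borel \<in> sets (borel :: (real ^ 'a) measure))"
    by simp
qed

text \<open>Indexing orthants by the set of coordinates where \<eta> is 1 turns the minimum in
  \<open>O_Med_bias\<close> into one over sign patterns.\<close>

lemma orthants_eq_sign_sets:
  "orthants = range (\<lambda>S :: 'd::finite set. {x. \<forall>j. if j \<in> S then x $ j \<ge> 0 else x $ j \<le> 0})"
  (is "_ = range ?O")
proof (intro equalityI subsetI)
  fix A :: "(real ^ 'd) set" assume "A \<in> orthants"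
  then obtain \<eta> :: "real ^ 'd" where \<eta>: "\<And>j. \<eta> $ j \<in> {-1, 1}"
    and A: "A = {x. \<forall>j. \<eta> $ j * x $ j \<ge> 0}"
    by (auto simp: orthants_def)
  have "(\<eta> $ j * x \<ge> 0) = (if j \<in> {j. \<eta> $ j = 1} then x \<ge> 0 else x \<le> 0)" for j x
    using \<eta>[of j] by auto
  then have "A = ?O {j. \<eta> $ j = 1}"
    by (simp add: A)
  then show "A \<in> range ?O" by blast
next
  fix A :: "(real ^ 'd) set" assume "A \<in> range ?O"
  then obtain S where A: "A = ?O S" by blast
  let ?\<eta> = "(\<chi> j. if j \<in> S then 1 else -1) :: real ^ 'd"
  have "(?\<eta> $ j * x \<ge> 0) = (if j \<in> S then x \<ge> 0 else x \<le> 0)" for j x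
    by simp
  then have "A = {x. \<forall>j. ?\<eta> $ j * x $ j \<ge> 0}"
    by (simp add: A)
  moreover have "\<forall>j. ?\<eta> $ j \<in> {-1, 1}" by simp
  ultimately show "A \<in> orthants"
    unfolding orthants_def by blast
qed

lemma (in prob_space) MCH_AE_nonzero:
  assumes "MCH M W"
  shows "AE \<omega> in M. \<forall>j. W \<omega> $ j \<noteq> 0"
proof -
  have [measurable]: "W \<in> borel_measurable M"
    using assms by (simp add: MCH_def)
  have "{\<omega> \<in> space M. \<exists>j. W \<omega> $ j = 0} \<in> events"
    by measurable
  then have "AE \<omega> in M. \<omega> \<notin> {\<omega> \<in> space M. \<exists>j. W \<omega> $ j = 0}"
    using assms by (intro AE_not_in) (auto simp: MCH_def null_sets_def emeasure_eq_measure)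
  then show ?thesis by auto
qed

text \<open>The two events differ only where some coordinate vanishes, which has probability zero
  under \<open>MCH\<close>.\<close>

lemma (in prob_space) prob_orthant_eq_prob_pos_coords:
  fixes W :: "'a \<Rightarrow> real ^ 'd"
  assumes "MCH M W"
  shows "\<P>(\<omega> in M. W \<omega> \<in> {x. \<forall>j. if j \<in> S then x $ j \<ge> 0 else x $ j \<le> 0})
       = \<P>(\<omega> in M. pos_coords (W \<omega>) = S)"
proof -
  have [measurable]: "W \<in> borel_measurable M"
    using assms by (simp add: MCH_def)
  show ?thesis
  proof (rule finite_measure_eq_AE)
    show "AE \<omega> in M. \<omega> \<in> {\<omega> \<in> space M. W \<omega> \<in> {x. \<forall>j. if j \<in> S then x $ j \<ge> 0 else x $ j \<le> 0}}
        \<longleftrightarrow> \<omega> \<in> {\<omega> \<in> space M. pos_coords (W \<omega>) = S}"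
      using MCH_AE_nonzero[OF assms]
    proof eventually_elim
      case (elim \<omega>)
      then have "(if j \<in> S then W \<omega> $ j \<ge> 0 else W \<omega> $ j \<le> 0) \<longleftrightarrow> (0 < W \<omega> $ j \<longleftrightarrow> j \<in> S)" for j
        by (smt (verit))
      then show ?case
        by (simp add: pos_coords_def set_eq_iff)
    qed
    have "{\<omega> \<in> space M. \<forall>j. if j \<in> S then W \<omega> $ j \<ge> 0 else W \<omega> $ j \<le> 0} \<in> events"
      by measurable
    then show "{\<omega> \<in> space M. W \<omega> \<in> {x. \<forall>j. if j \<in> S then x $ j \<ge> 0 else x $ j \<le> 0}} \<in> events"
      by simp
    show "{\<omega> \<in> space M. pos_coords (W \<omega>) = S} \<in> events"
      by measurable
  qed
qed

text \<open>
  The positive part in \<^const>\<open>O_Med_bias\<close> is inactive: the pattern probabilities sum to 1, so their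
  minimum is at most \<open>1/2^d\<close>.
\<close>

lemma (in prob_space) O_Med_bias_eq_Min:
  fixes X :: "'a \<Rightarrow> real ^ 'd"
  assumes "MCH M (\<lambda>\<omega>. X \<omega> - \<theta>)"
  defines "m \<equiv> Min (range (\<lambda>S. \<P>(\<omega> in M. pos_coords (X \<omega> - \<theta>) = S)))"
  shows "m = 1 / 2 ^ CARD('d) - O_Med_bias M X \<theta> / 2 ^ (CARD('d) - 1)"
proof -
  let ?q = "\<lambda>S. \<P>(\<omega> in M. pos_coords (X \<omega> - \<theta>) = S)"
  have [measurable]: "(\<lambda>\<omega>. X \<omega> - \<theta>) \<in> borel_measurable M"
    using assms(1) by (simp add: MCH_def)
  have "(\<Sum>S\<in>(UNIV :: 'd set set). m) \<le> (\<Sum>S\<in>UNIV. ?q S)"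
    unfolding m_def by (intro sum_mono Min_le) auto
  also have "\<dots> = 1"
    by (subst sum_prob_finite_partition) (auto simp: prob_space)
  finally have "m \<le> 1 / 2 ^ CARD('d)"
    by (simp add: card_UNIV_set field_simps)
  moreover have "O_Med_bias M X \<theta> = 2 ^ (CARD('d) - 1) * max (1 / 2 ^ CARD('d) - m) 0"
    using prob_orthant_eq_prob_pos_coords[OF assms(1)]
    unfolding O_Med_bias_def m_def orthants_eq_sign_sets image_image by simp
  ultimately show ?thesis
    by simp
qed

text \<open>The point escapes in coordinate \<open>j\<close> iff all estimates lie strictly on one
  side of it. Nonvanishing errors turn "not positive" into "negative".\<close>

lemma not_in_Rect_Hull_iff:
  fixes v :: "nat \<Rightarrow> real ^ 'd"
  assumes "B \<ge> 1" and nz: "\<And>k j. k \<in> {1..B} \<Longrightarrow> (v k - \<theta>) $ j \<noteq> 0"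
  shows "\<theta> \<notin> Rect_Hull B v \<longleftrightarrow>
    (\<exists>j. (\<forall>k\<in>{1..B}. j \<in> pos_coords (v k - \<theta>)) \<or> (\<forall>k\<in>{1..B}. j \<notin> pos_coords (v k - \<theta>)))"
proof -
  have "(\<theta> $ j < Min ((\<lambda>k. v k $ j) ` {1..B})) = (\<forall>k\<in>{1..B}. j \<in> pos_coords (v k - \<theta>))" for j
    using \<open>B \<ge> 1\<close> by (subst Min_gr_iff) (auto simp: pos_coords_def)
  moreover have "(Max ((\<lambda>k. v k $ j) ` {1..B}) < \<theta> $ j)
      = (\<forall>k\<in>{1..B}. j \<notin> pos_coords (v k - \<theta>))" for j
  proof -
    have "v k $ j < \<theta> $ j \<longleftrightarrow> j \<notin> pos_coords (v k - \<theta>)" if "k \<in> {1..B}" for k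
      using nz[OF that, of j] by (auto simp: pos_coords_def)
    then show ?thesis
      using \<open>B \<ge> 1\<close> by (subst Max_less_iff) auto
  qed
  ultimately show ?thesis
    unfolding Rect_Hull_def by (simp add: not_le)
qed

theorem theorem3p2:
  fixes M :: "'s measure" and X :: "nat \<Rightarrow> 's \<Rightarrow> real ^ 'd"
    and \<theta>\<^sub>0 :: "real ^ 'd" and B :: nat and \<delta> :: real
  assumes "prob_space M"
    and "B \<ge> 1"
    and "prob_space.indep_vars M (\<lambda>_. borel) X {1..B}"
    and "\<And>k. k \<in> {1..B} \<Longrightarrow> distr M borel (X k) = distr M borel (X 1)"
    and "MCH M (\<lambda>\<omega>. X 1 \<omega> - \<theta>\<^sub>0)"
    and "\<delta> = O_Med_bias M (X 1) \<theta>\<^sub>0"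
  shows "L_bound B \<delta> CARD('d) \<le> measure M {\<omega> \<in> space M. \<theta>\<^sub>0 \<notin> Rect_Hull B (\<lambda>k. X k \<omega>)}
       \<and> measure M {\<omega> \<in> space M. \<theta>\<^sub>0 \<notin> Rect_Hull B (\<lambda>k. X k \<omega>)} \<le> U_bound B \<delta> CARD('d)"
proof -
  interpret prob_space M by fact
  note ind = assms(3) and mch = assms(5)
  have X [measurable]: "X k \<in> borel_measurable M" if "k \<in> {1..B}" for k
    using ind that unfolding indep_vars_def by blast
  have ident: "\<P>(\<omega> in M. P (X k \<omega>)) = \<P>(\<omega> in M. P (X 1 \<omega>))"
    if k: "k \<in> {1..B}" and P: "{x. P x} \<in> sets borel" for k P
  proof -
    have "\<P>(\<omega> in M. P (X i \<omega>)) = measure (distr M borel (X i)) {x. P x}" if "i \<in> {1..B}" for i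
      using X[OF that] P by (simp add: measure_distr vimage_def Int_def conj_commute)
    then show ?thesis
      using assms(4)[OF k] k \<open>B \<ge> 1\<close> by simp
  qed
  define \<sigma> where "\<sigma> k \<omega> = pos_coords (X k \<omega> - \<theta>\<^sub>0)" for k \<omega>
  have pos_meas: "(\<lambda>x. pos_coords (x - \<theta>\<^sub>0)) \<in> borel \<rightarrow>\<^sub>M count_space UNIV"
    by measurable
  have \<sigma>_ind: "indep_vars (\<lambda>_. count_space UNIV) \<sigma> {1..B}"
    unfolding \<sigma>_def by (rule indep_vars_compose2[OF ind pos_meas])
  have \<sigma>_ident: "\<P>(\<omega> in M. \<sigma> k \<omega> \<in> S) = \<P>(\<omega> in M. \<sigma> 1 \<omega> \<in> S)" if "k \<in> {1..B}" for k S
    unfolding \<sigma>_def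
    using measurable_sets[OF pos_meas, of S] by (intro ident that) (simp add: vimage_def)
  have "AE \<omega> in M. \<forall>j. (X k \<omega> - \<theta>\<^sub>0) $ j \<noteq> 0" if "k \<in> {1..B}" for k
  proof -
    have borel: "{x :: real ^ 'd. \<exists>j. (x - \<theta>\<^sub>0) $ j = 0} \<in> sets borel"
      by measurable
    \<comment> \<open>Equality in distribution carries the null event over from
      \<open>X 1\<close>.\<close>
    have "MCH M (\<lambda>\<omega>. X k \<omega> - \<theta>\<^sub>0)"
      using mch ident[OF that borel] X[OF that] by (simp add: MCH_def)
    then show ?thesis
      by (rule MCH_AE_nonzero)
  qed
  then have nz: "AE \<omega> in M. \<forall>k\<in>{1..B}. \<forall>j. (X k \<omega> - \<theta>\<^sub>0) $ j \<noteq> 0"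
    by (intro AE_finite_allI) auto
  let ?hull = "{\<omega> \<in> space M. \<theta>\<^sub>0 \<notin> Rect_Hull B (\<lambda>k. X k \<omega>)}"
  let ?const = "{\<omega> \<in> space M. \<exists>j. (\<forall>k\<in>{1..B}. j \<in> \<sigma> k \<omega>) \<or> (\<forall>k\<in>{1..B}. j \<notin> \<sigma> k \<omega>)}"
  have "prob ?hull = prob ?const"
  proof (rule finite_measure_eq_AE)
    show "AE \<omega> in M. \<omega> \<in> ?hull \<longleftrightarrow> \<omega> \<in> ?const"
      using nz
    proof eventually_elim
      case (elim \<omega>)
      then show ?case
        using not_in_Rect_Hull_iff[OF \<open>B \<ge> 1\<close>, of "\<lambda>k. X k \<omega>" \<theta>\<^sub>0] by (simp add: \<sigma>_def)
    qed
    have [measurable]: "\<sigma> k \<in> M \<rightarrow>\<^sub>M count_space UNIV" if "k \<in> {1..B}" for k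
      using \<sigma>_ind that unfolding indep_vars_def by blast
    show "?const \<in> events"
      by measurable
    \<comment> \<open>The description by sign patterns holds only almost everywhere, so
      measurability of the hull event comes from an exact description by strict
      inequalities.\<close>
    have "{\<omega> \<in> space M. \<exists>j. (\<forall>k\<in>{1..B}. \<theta>\<^sub>0 $ j < X k \<omega> $ j) \<or> (\<forall>k\<in>{1..B}. X k \<omega> $ j < \<theta>\<^sub>0 $ j)} \<in> events"
      by measurable
    moreover have "\<theta>\<^sub>0 \<notin> Rect_Hull B v \<longleftrightarrow>
        (\<exists>j. (\<forall>k\<in>{1..B}. \<theta>\<^sub>0 $ j < v k $ j) \<or> (\<forall>k\<in>{1..B}. v k $ j < \<theta>\<^sub>0 $ j))" for v
      using \<open>B \<ge> 1\<close> unfolding Rect_Hull_def by (simp add: not_le Min_gr_iff Max_less_iff)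
    ultimately show "?hull \<in> events"
      by simp
  qed
  moreover have "L_bound B \<delta> CARD('d) \<le> prob ?const" "prob ?const \<le> U_bound B \<delta> CARD('d)"
  proof -
    \<comment> \<open>The smallest pattern probability; its deficit from the uniform value is what
      \<delta> measures.\<close>
    define m where "m = Min (range (\<lambda>S. \<P>(\<omega> in M. \<sigma> 1 \<omega> = S)))"
    have "0 \<le> m" "\<And>S. m \<le> \<P>(\<omega> in M. \<sigma> 1 \<omega> = S)"
      by (auto simp: m_def)
    moreover have "m = 1 / 2 ^ CARD('d) - \<delta> / 2 ^ (CARD('d) - 1)"
      using O_Med_bias_eq_Min[OF mch] by (simp add: m_def \<sigma>_def assms(6))
    ultimately show "L_bound B \<delta> CARD('d) \<le> prob ?const" "prob ?const \<le> U_bound B \<delta> CARD('d)"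
      using prob_constant_coordinate_bounds[OF \<sigma>_ind \<open>B \<ge> 1\<close> \<sigma>_ident] by blast+
  qed
  ultimately show ?thesis
    by simp
qed

end
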